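(* Let $\mathcal{B}$ be a reflexive Banach space over $\mathbb{K}\in\{\mathbb{R},\mathbb{C}\}$. Suppose that $\Phi=(\varphi_\lambda)_{\lambda\in\Lambda}\subset\mathcal{B}'$ constitutes a frame for $\mathcal{B}$ with associated admissible Banach space $\mathfrak{B}\subset\mathbb{K}^\Lambda$, and that $\mathcal{A}_\Phi:\mathbb{P}_{\mathbb{K}}\mathcal{B}\to\mathfrak{B}$, $\mathcal{A}_\Phi(x)=|[x,\Phi]|$, is injective. Then the inverse $\mathcal{A}_\Phi^{-1}$, defined on the range of $\mathcal{A}_\Phi$ (with the metric induced by $\|\cdot\|_{\mathfrak{B}}$) with values in $(\mathbb{P}_{\mathbb{K}}\mathcal{B},d_{\mathcal{B}})$, is continuous.
   Context: Notation. $\mathcal{B}'$ is the topological dual of $\mathcal{B}$ with its norm, $[x,\psi]:=\psi(x)$, $[x,\Phi]:=([x,\varphi_\lambda])_{\lambda\in\Lambda}\in\mathbb{K}^\Lambda$ and $|[x,\Phi]|:=(|[x,\varphi_\lambda]|)_{\lambda\in\Lambda}$. For $S\subset\Lambda$, $\chi_S$ is the indicator function of $S$. $\mathbb{P}_{\mathbb{K}}\mathcal{B}$ is the quotient of $\mathcal{B}$ identifying $x$ with $\tau x$ for all $\tau\in\mathbb{K}$, $|\tau|=1$, with the distance $d_{\mathcal{B}}(x,y)=\min\{\|x-\tau y\|_{\mathcal{B}}:\tau\in\mathbb{K},|\tau|=1\}$. Admissible Banach space. Let $\Lambda$ be a $\sigma$-compact topological space. A Banach space $\mathfrak{B}\subset\mathbb{K}^\Lambda$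 over $\mathbb{K}$ is admissible if (with the convention $\|w\|_{\mathfrak{B}}=\infty$ for $w\in\mathbb{K}^\Lambda\setminus\mathfrak{B}$): (i) $\|\chi_{\Lambda'}\|_{\mathfrak{B}}<\infty$ for every compact $\Lambda'\subset\Lambda$; (ii) $\mathfrak{B}$ is solid: $\|w\|_{\mathfrak{B}}=\||w|\|_{\mathfrak{B}}\le\|z\|_{\mathfrak{B}}$ for all $z\in\mathfrak{B}$ and $w$ with $|z(\lambda)|\ge|w(\lambda)|$ for all $\lambda\in\Lambda$; (iii) the elements of $\mathfrak{B}$ with compact support are dense in $\mathfrak{B}$. Frame. A family $\Phi=(\varphi_\lambda)_{\lambda\in\Lambda}\subset\mathcal{B}'$ with $\lambda\mapsto\varphi_\lambda$ continuous is a frame for $\mathcal{B}$ with associated admissible Banach space $\mathfrak{B}\subset\mathbb{K}^\Lambda$ if (B1) there are real constants $B\ge A>0$ with $A\|x\|_{\mathcal{B}}\le\|[x,\Phi]\|_{\mathfrak{B}}\le B\|x\|_{\mathcal{B}}$ for all $x\in\mathcal{B}$; and (B2) there is a continuous operator $R:\mathfrak{B}\to\mathcal{B}$ with $R([x,\Phi])=x$ for all $x\in\mathcal{B}$. *)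

theory Defs
  imports "HOL-Analysis.Analysis"
begin

section \<open>The scalar field\<close>

text \<open>A field of this class is an isometric copy of the field of real or of complex numbers.\<close>

class real_or_complex = real_normed_field +
  assumes iso_real_or_complex:
    "(\<exists>f :: 'a \<Rightarrow> real. bij f \<and> (\<forall>x y. f (x + y) = f x + f y) \<and>
        (\<forall>x y. f (x * y) = f x * f y) \<and> (\<forall>x. norm (f x) = norm x)) \<or>
     (\<exists>f :: 'a \<Rightarrow> complex. bij f \<and> (\<forall>x y. f (x + y) = f x + f y) \<and>
        (\<forall>x y. f (x * y) = f x * f y) \<and> (\<forall>x. norm (f x) = norm x))"

instance real :: real_or_complex
  by standard (rule disjI1, rule exI[of _ id], simp)

instance complex :: real_or_complex
  by standard (rule disjI2, rule exI[of _ id], simp)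

lemma compact_unit_scalars: "compact {t :: 'k::real_or_complex. norm t = 1}"
proof -
  have aux: "compact {t :: 'k. norm t = 1}"
    if f: "bij f" "\<And>x y. f (x + y) = f x + f y" "\<And>x. norm (f x) = norm x"
    for f :: "'k \<Rightarrow> 'c::euclidean_space"
  proof -
    have diff: "f (x - y) = f x - f y" for x y
      using f(2)[of "x - y" y] by (simp add: algebra_simps)
    have g: "f (inv f z) = z" for z
      using f(1) by (simp add: bij_is_surj surj_f_inv_f)
    have iso: "dist (inv f z) (inv f w) = dist z w" for z w
      by (metis dist_norm diff f(3) g)
    have ng: "norm (inv f z) = norm z" for z
      by (metis f(3) g)
    have cont: "continuous_on (sphere 0 1) (inv f)"
      unfolding continuous_on_iff by (auto simp: iso)
    have "{t. norm t = 1} = inv f ` sphere 0 1"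
    proof (intro set_eqI iffI)
      fix t assume "t \<in> {t :: 'k. norm t = 1}"
      then have "f t \<in> sphere 0 1" by (simp add: f(3))
      moreover have "t = inv f (f t)" using f(1) by (simp add: bij_is_inj)
      ultimately show "t \<in> inv f ` sphere 0 1" by blast
    qed (auto simp: ng)
    then show ?thesis
      using compact_continuous_image[OF cont compact_sphere] by simp
  qed
  from iso_real_or_complex[where 'a = 'k] show ?thesis
    by (elim disjE exE conjE) (rule aux; blast)+
qed

section \<open>Normed spaces over the scalar field, duals, reflexivity\<close>

text \<open>
  \<open>smul\<close> is the scalar multiplication by elements of the scalar field. The real normed
  structure of the type is its restriction of scalars, so that \<^typ>\<open>'b::banach\<close> provides
  completeness.
\<close>

locale normed_space_over = vector_space smul
  for smul :: "'k::real_normed_field \<Rightarrow> 'b::real_normed_vector \<Rightarrow> 'b" +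
  assumes scale_of_real: "smul (of_real r) x = r *\<^sub>R x"
    and norm_scale: "norm (smul a x) = norm a * norm x"

text \<open>
  The library type \<^typ>\<open>'b \<Rightarrow>\<^sub>L 'k\<close> consists of all bounded real-linear maps; the
  topological dual is the subspace of those linear over the scalar field, with the operator norm.
\<close>

definition dual ::
  "('k::real_normed_field \<Rightarrow> 'b::real_normed_vector \<Rightarrow> 'b) \<Rightarrow> ('b \<Rightarrow>\<^sub>L 'k) set" where
  "dual smul = {\<psi>. \<forall>a x. blinfun_apply \<psi> (smul a x) = a * blinfun_apply \<psi> x}"

definition dual_scale :: "'k::real_normed_field \<Rightarrow> ('b::real_normed_vector \<Rightarrow>\<^sub>L 'k) \<Rightarrow> ('b \<Rightarrow>\<^sub>L 'k)" where
  "dual_scale a \<psi> = blinfun_mult_right a o\<^sub>L \<psi>"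

lemma dual_scale_apply: "blinfun_apply (dual_scale a \<psi>) x = a * blinfun_apply \<psi> x"
  by (simp add: dual_scale_def)

text \<open>Only the values of a bidual element on \<^term>\<open>dual smul\<close> are relevant.\<close>

definition bidual ::
  "('k::real_normed_field \<Rightarrow> 'b::real_normed_vector \<Rightarrow> 'b) \<Rightarrow> (('b \<Rightarrow>\<^sub>L 'k) \<Rightarrow> 'k) set" where
  "bidual smul = {F.
     (\<forall>\<psi>\<in>dual smul. \<forall>\<theta>\<in>dual smul. F (\<psi> + \<theta>) = F \<psi> + F \<theta>) \<and>
     (\<forall>a. \<forall>\<psi>\<in>dual smul. F (dual_scale a \<psi>) = a * F \<psi>) \<and>
     (\<exists>C. \<forall>\<psi>\<in>dual smul. norm (F \<psi>) \<le> C * norm \<psi>)}"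

definition reflexive ::
  "('k::real_normed_field \<Rightarrow> 'b::real_normed_vector \<Rightarrow> 'b) \<Rightarrow> bool" where
  "reflexive smul \<longleftrightarrow>
     (\<forall>F\<in>bidual smul. \<exists>x. \<forall>\<psi>\<in>dual smul. F \<psi> = blinfun_apply \<psi> x)"

section \<open>Identification up to a unimodular factor\<close>

definition phase_rel ::
  "('k::real_normed_field \<Rightarrow> 'b::real_normed_vector \<Rightarrow> 'b) \<Rightarrow> ('b \<times> 'b) set" where
  "phase_rel smul = {(x, y). \<exists>\<tau>. norm \<tau> = 1 \<and> y = smul \<tau> x}"

definition phase_space ::
  "('k::real_normed_field \<Rightarrow> 'b::real_normed_vector \<Rightarrow> 'b) \<Rightarrow> 'b set set" where
  "phase_space smul = UNIV // phase_rel smul"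

text \<open>The infimum is attained, see \<open>vec_phase_dist_attained\<close> below.\<close>

definition vec_phase_dist ::
  "('k::real_normed_field \<Rightarrow> 'b::real_normed_vector \<Rightarrow> 'b) \<Rightarrow> 'b \<Rightarrow> 'b \<Rightarrow> real" where
  "vec_phase_dist smul x y = Inf {norm (x - smul \<tau> y) | \<tau>. norm \<tau> = 1}"

text \<open>
  Functions on the quotient are evaluated on an arbitrary representative;
  \<open>phase_dist_class\<close> and \<open>abs_coeffs_class\<close> show that the choice does not matter.
\<close>

definition rep :: "'b set \<Rightarrow> 'b" where
  "rep P = (SOME x. x \<in> P)"

definition phase_dist ::
  "('k::real_normed_field \<Rightarrow> 'b::real_normed_vector \<Rightarrow> 'b) \<Rightarrow> 'b set \<Rightarrow> 'b set \<Rightarrow> real" where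
  "phase_dist smul P Q = vec_phase_dist smul (rep P) (rep Q)"

definition coeffs :: "('l \<Rightarrow> ('b::real_normed_vector \<Rightarrow>\<^sub>L 'k::real_normed_field)) \<Rightarrow> 'b \<Rightarrow> 'l \<Rightarrow> 'k" where
  "coeffs \<phi> x = (\<lambda>l. blinfun_apply (\<phi> l) x)"

definition absf :: "('l \<Rightarrow> 'k::real_normed_field) \<Rightarrow> 'l \<Rightarrow> 'k" where
  "absf w = (\<lambda>l. of_real (norm (w l)))"

definition abs_coeffs ::
  "('l \<Rightarrow> ('b::real_normed_vector \<Rightarrow>\<^sub>L 'k::real_normed_field)) \<Rightarrow> 'b set \<Rightarrow> 'l \<Rightarrow> 'k" where
  "abs_coeffs \<phi> P = absf (coeffs \<phi> (rep P))"

context normed_space_over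
begin

lemma equiv_phase_rel: "equiv UNIV (phase_rel smul)"
proof (rule equivI)
  show "refl (phase_rel smul)"
    unfolding refl_on_def phase_rel_def by (auto intro!: exI[of _ 1])
  show "sym (phase_rel smul)"
  proof (rule symI)
    fix x y assume "(x, y) \<in> phase_rel smul"
    then obtain t where t: "norm t = 1" "y = smul t x" by (auto simp: phase_rel_def)
    then have "t \<noteq> 0" by auto
    with t have "norm (inverse t) = 1" "x = smul (inverse t) y"
      by (simp_all add: norm_inverse)
    then show "(y, x) \<in> phase_rel smul" unfolding phase_rel_def by blast
  qed
  show "trans (phase_rel smul)"
    unfolding trans_def phase_rel_def
    by clarsimp (metis norm_mult mult_1)
qed simp

lemma vec_phase_dist_le: "norm t = 1 \<Longrightarrow> vec_phase_dist smul x y \<le> norm (x - smul t y)"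
  unfolding vec_phase_dist_def
  by (rule cInf_lower) (auto intro!: bdd_belowI[where m = 0])

lemma vec_phase_dist_ge:
  assumes "\<And>t. norm t = 1 \<Longrightarrow> c \<le> norm (x - smul t y)"
  shows "c \<le> vec_phase_dist smul x y"
proof -
  have "norm (x - smul 1 y) \<in> {norm (x - smul \<tau> y) | \<tau>. norm \<tau> = 1}"
    using norm_one by blast
  then show ?thesis
    unfolding vec_phase_dist_def using assms by (intro cInf_greatest) auto
qed

lemma vec_phase_dist_nonneg: "0 \<le> vec_phase_dist smul x y"
  by (rule vec_phase_dist_ge) simp

lemma norm_diff_scale:
  assumes "norm s = 1"
  shows "norm (smul s x - y) = norm (x - smul (inverse s) y)"
proof -
  have "s \<noteq> 0" using assms by auto
  then have "smul s x - y = smul s (x - smul (inverse s) y)"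
    by (simp add: scale_right_diff_distrib)
  then show ?thesis using assms by (simp add: norm_scale)
qed

lemma vec_phase_dist_commute_le: "vec_phase_dist smul x y \<le> vec_phase_dist smul y x"
proof (rule vec_phase_dist_ge)
  fix t :: 'k assume t: "norm t = 1"
  have "vec_phase_dist smul x y \<le> norm (x - smul (inverse t) y)"
    by (rule vec_phase_dist_le) (simp add: t norm_inverse)
  also have "\<dots> = norm (y - smul t x)"
    using norm_diff_scale[OF t, of x y] by (simp add: norm_minus_commute)
  finally show "vec_phase_dist smul x y \<le> norm (y - smul t x)" .
qed

lemma vec_phase_dist_commute: "vec_phase_dist smul x y = vec_phase_dist smul y x"
  by (intro antisym vec_phase_dist_commute_le)

lemma vec_phase_dist_triangle:
  "vec_phase_dist smul x z \<le> vec_phase_dist smul x y + vec_phase_dist smul y z"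
proof -
  have "vec_phase_dist smul x z - norm (x - smul s y) \<le> vec_phase_dist smul y z"
    if s: "norm s = 1" for s
  proof (rule vec_phase_dist_ge)
    fix t :: 'k assume t: "norm t = 1"
    have "vec_phase_dist smul x z \<le> norm (x - smul (s * t) z)"
      by (rule vec_phase_dist_le) (simp add: s t norm_mult)
    also have "x - smul (s * t) z = (x - smul s y) + smul s (y - smul t z)"
      by (simp add: scale_right_diff_distrib)
    also have "norm \<dots> \<le> norm (x - smul s y) + norm (y - smul t z)"
      by (rule order_trans[OF norm_triangle_ineq]) (simp add: norm_scale s)
    finally show "vec_phase_dist smul x z - norm (x - smul s y) \<le> norm (y - smul t z)"
      by simp
  qed
  then have "vec_phase_dist smul x z - vec_phase_dist smul y z \<le> vec_phase_dist smul x y"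
    by (intro vec_phase_dist_ge) (simp add: algebra_simps)
  then show ?thesis by simp
qed

lemma vec_phase_dist_scale_left_le:
  assumes "norm s = 1"
  shows "vec_phase_dist smul (smul s x) y \<le> vec_phase_dist smul x y"
proof (rule vec_phase_dist_ge)
  fix t :: 'k assume t: "norm t = 1"
  have nz: "s \<noteq> 0" using assms by auto
  have "vec_phase_dist smul (smul s x) y \<le> norm (smul s x - smul (s * t) y)"
    by (rule vec_phase_dist_le) (simp add: assms t norm_mult)
  also have "\<dots> = norm (x - smul t y)"
    unfolding norm_diff_scale[OF assms] using nz by (simp add: mult.assoc[symmetric])
  finally show "vec_phase_dist smul (smul s x) y \<le> norm (x - smul t y)" .
qed

lemma vec_phase_dist_scale_left:
  assumes "norm s = 1"
  shows "vec_phase_dist smul (smul s x) y = vec_phase_dist smul x y"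
proof (rule antisym)
  have "s \<noteq> 0" using assms by auto
  then show "vec_phase_dist smul x y \<le> vec_phase_dist smul (smul s x) y"
    using vec_phase_dist_scale_left_le[of "inverse s" "smul s x" y] assms
    by (simp add: norm_inverse)
qed (rule vec_phase_dist_scale_left_le[OF assms])

lemma rep_class: "\<exists>\<tau>. norm \<tau> = 1 \<and> rep (phase_rel smul `` {x}) = smul \<tau> x"
proof -
  have "x \<in> phase_rel smul `` {x}"
    using equiv_class_self[OF equiv_phase_rel] by simp
  then have "rep (phase_rel smul `` {x}) \<in> phase_rel smul `` {x}"
    unfolding rep_def by (rule someI)
  then show ?thesis by (auto simp: phase_rel_def)
qed

lemma phase_dist_class:
  "phase_dist smul (phase_rel smul `` {x}) (phase_rel smul `` {y}) = vec_phase_dist smul x y"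
proof -
  obtain s t where s: "norm s = 1" "rep (phase_rel smul `` {x}) = smul s x"
    and t: "norm t = 1" "rep (phase_rel smul `` {y}) = smul t y"
    using rep_class[of x] rep_class[of y] by blast
  have "vec_phase_dist smul x (smul t y) = vec_phase_dist smul x y"
    unfolding vec_phase_dist_commute[of x] by (rule vec_phase_dist_scale_left[OF t(1)])
  then show ?thesis
    by (simp add: phase_dist_def s t vec_phase_dist_scale_left)
qed

lemma abs_coeffs_class:
  assumes "range \<phi> \<subseteq> dual smul"
  shows "abs_coeffs \<phi> (phase_rel smul `` {x}) = absf (coeffs \<phi> x)"
proof -
  obtain t where t: "norm t = 1" "rep (phase_rel smul `` {x}) = smul t x"
    using rep_class by blast
  have "blinfun_apply (\<phi> l) (smul t x) = t * blinfun_apply (\<phi> l) x" for l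
    using assms by (auto simp: dual_def)
  then show ?thesis
    by (simp add: abs_coeffs_def absf_def coeffs_def t norm_mult)
qed

end

lemma vec_phase_dist_attained:
  fixes smul :: "'k::real_or_complex \<Rightarrow> 'b::real_normed_vector \<Rightarrow> 'b"
  assumes "normed_space_over smul"
  shows "\<exists>\<tau>. norm \<tau> = 1 \<and> vec_phase_dist smul x y = norm (x - smul \<tau> y)"
proof -
  interpret normed_space_over smul by fact
  have "continuous_on {t. norm t = 1} (\<lambda>t. smul t y)"
  proof (rule linear_continuous_on)
    show "bounded_linear (\<lambda>t. smul t y)"
    proof (rule bounded_linear_intro[where K = "norm y"])
      show "smul (r *\<^sub>R t) y = r *\<^sub>R smul t y" for r t
        by (metis scaleR_conv_of_real scale_of_real scale_scale)
    qed (auto simp: scale_left_distrib norm_scale)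
  qed
  then have "continuous_on {t. norm t = 1} (\<lambda>t. norm (x - smul t y))"
    by (intro continuous_intros)
  moreover have "{t :: 'k. norm t = 1} \<noteq> {}" using norm_one by blast
  ultimately have "\<exists>s\<in>{t. norm t = 1}.
      \<forall>t\<in>{t. norm t = 1}. norm (x - smul s y) \<le> norm (x - smul t y)"
    by (intro continuous_attains_inf compact_unit_scalars)
  then obtain s where s: "norm s = 1"
    "\<And>t. norm t = 1 \<Longrightarrow> norm (x - smul s y) \<le> norm (x - smul t y)"
    by auto
  have "vec_phase_dist smul x y = norm (x - smul s y)"
    by (rule antisym[OF vec_phase_dist_le[OF s(1)] vec_phase_dist_ge[OF s(2)]])
  with s show ?thesis by blast
qed

lemma Metric_space_phase_space:
  fixes smul :: "'k::real_or_complex \<Rightarrow> 'b::real_normed_vector \<Rightarrow> 'b"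
  assumes "normed_space_over smul"
  shows "Metric_space (phase_space smul) (phase_dist smul)"
proof -
  interpret normed_space_over smul by fact
  show ?thesis
  proof
    fix P Q assume "P \<in> phase_space smul" "Q \<in> phase_space smul"
    then obtain x y where
      PQ: "P = phase_rel smul `` {x}" "Q = phase_rel smul `` {y}"
      by (auto simp: phase_space_def quotient_def)
    have "P = Q \<longleftrightarrow> (y, x) \<in> phase_rel smul"
      unfolding PQ using equiv_phase_rel eq_equiv_class_iff by (metis UNIV_I)
    also have "\<dots> \<longleftrightarrow> vec_phase_dist smul x y = 0"
    proof
      assume "(y, x) \<in> phase_rel smul"
      then show "vec_phase_dist smul x y = 0"
        using vec_phase_dist_le[of _ x y] vec_phase_dist_nonneg[of x y]
        by (fastforce simp: phase_rel_def intro: antisym)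
    next
      assume "vec_phase_dist smul x y = 0"
      then show "(y, x) \<in> phase_rel smul"
        using vec_phase_dist_attained[OF assms, of x y] by (auto simp: phase_rel_def)
    qed
    finally show "phase_dist smul P Q = 0 \<longleftrightarrow> P = Q"
      by (simp add: PQ phase_dist_class)
  qed (simp_all add: phase_dist_def vec_phase_dist_nonneg vec_phase_dist_triangle,
       rule vec_phase_dist_commute)
qed

section \<open>Admissible Banach spaces of scalar functions\<close>

text \<open>
  A normed space of functions is encoded by its norm alone, extended by \<open>\<infinity>\<close> to all functions:
  the space is \<^term>\<open>fspace N\<close>, the set where the norm is finite. The axioms, together with
  \<open>0 * \<infinity> = 0\<close>, make this set a linear subspace.
\<close>

locale function_norm =
  fixes N :: "('l \<Rightarrow> 'k::real_normed_field) \<Rightarrow> ennreal"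
  assumes N_eq_0_iff: "N w = 0 \<longleftrightarrow> w = (\<lambda>l. 0)"
    and N_scale: "N (\<lambda>l. a * w l) = ennreal (norm a) * N w"
    and N_triangle: "N (\<lambda>l. v l + w l) \<le> N v + N w"

definition fspace :: "(('l \<Rightarrow> 'k::real_normed_field) \<Rightarrow> ennreal) \<Rightarrow> ('l \<Rightarrow> 'k) set" where
  "fspace N = {w. N w < \<infinity>}"

definition fdist ::
  "(('l \<Rightarrow> 'k::real_normed_field) \<Rightarrow> ennreal) \<Rightarrow> ('l \<Rightarrow> 'k) \<Rightarrow> ('l \<Rightarrow> 'k) \<Rightarrow> real" where
  "fdist N v w = enn2real (N (\<lambda>l. v l - w l))"

context function_norm
begin

lemma fspace_0: "(\<lambda>l. 0) \<in> fspace N"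
  using N_eq_0_iff[of "\<lambda>l. 0"] by (simp add: fspace_def)

lemma fspace_scale: "w \<in> fspace N \<Longrightarrow> (\<lambda>l. a * w l) \<in> fspace N"
  by (simp add: fspace_def N_scale ennreal_mult_less_top)

lemma fspace_add: "v \<in> fspace N \<Longrightarrow> w \<in> fspace N \<Longrightarrow> (\<lambda>l. v l + w l) \<in> fspace N"
  using N_triangle[of v w] by (auto simp: fspace_def intro: le_less_trans)

lemma fspace_diff: "v \<in> fspace N \<Longrightarrow> w \<in> fspace N \<Longrightarrow> (\<lambda>l. v l - w l) \<in> fspace N"
  using fspace_add[of v "\<lambda>l. - 1 * w l"] fspace_scale[of w "- 1"] by simp

lemma Metric_space_fspace: "Metric_space (fspace N) (fdist N)"
proof
  fix u v w :: "'l \<Rightarrow> 'k"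
  show "0 \<le> fdist N v w" by (simp add: fdist_def)
  show "fdist N v w = fdist N w v"
    using N_scale[of "- 1" "\<lambda>l. v l - w l"] by (simp add: fdist_def)
  show "fdist N v w = 0 \<longleftrightarrow> v = w" if "v \<in> fspace N" "w \<in> fspace N"
    using fspace_diff[OF that] N_eq_0_iff[of "\<lambda>l. v l - w l"]
    by (auto simp: fdist_def enn2real_eq_0_iff fspace_def fun_eq_iff)
  show "fdist N u w \<le> fdist N u v + fdist N v w"
    if "u \<in> fspace N" "v \<in> fspace N" "w \<in> fspace N"
  proof -
    have fin: "N (\<lambda>l. u l - v l) < \<infinity>" "N (\<lambda>l. v l - w l) < \<infinity>"
      using fspace_diff that by (auto simp: fspace_def)
    have "N (\<lambda>l. u l - w l) \<le> N (\<lambda>l. u l - v l) + N (\<lambda>l. v l - w l)"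
      using N_triangle[of "\<lambda>l. u l - v l" "\<lambda>l. v l - w l"] by simp
    then have "enn2real (N (\<lambda>l. u l - w l)) \<le> enn2real (N (\<lambda>l. u l - v l) + N (\<lambda>l. v l - w l))"
      using fin by (intro enn2real_mono) auto
    also have "\<dots> = enn2real (N (\<lambda>l. u l - v l)) + enn2real (N (\<lambda>l. v l - w l))"
      using fin by (intro enn2real_plus) auto
    finally show ?thesis by (simp add: fdist_def)
  qed
qed

end

locale admissible = function_norm N
  for N :: "('l::topological_space \<Rightarrow> 'k::real_normed_field) \<Rightarrow> ennreal" +
  assumes sigma_compact: "\<exists>K :: nat \<Rightarrow> 'l set. (\<forall>n. compact (K n)) \<and> (\<Union>n. K n) = UNIV"
    and complete: "Metric_space.mcomplete (fspace N) (fdist N)"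
    and indicator_finite: "compact L \<Longrightarrow> N (indicator L) < \<infinity>"
    and solid: "z \<in> fspace N \<Longrightarrow> (\<And>l. norm (w l) \<le> norm (z l)) \<Longrightarrow>
      N w = N (absf w) \<and> N (absf w) \<le> N z"
    and compact_support_dense:
      "Metric_space.mtopology (fspace N) (fdist N) closure_of
         {w \<in> fspace N. compact (closure {l. w l \<noteq> 0})} = fspace N"

section \<open>Frames\<close>

definition linear_on_fspace ::
  "('k::real_normed_field \<Rightarrow> 'b::real_normed_vector \<Rightarrow> 'b) \<Rightarrow> (('l \<Rightarrow> 'k) \<Rightarrow> ennreal) \<Rightarrow>
   (('l \<Rightarrow> 'k) \<Rightarrow> 'b) \<Rightarrow> bool" where
  "linear_on_fspace smul N R \<longleftrightarrow>
     (\<forall>v\<in>fspace N. \<forall>w\<in>fspace N. R (\<lambda>l. v l + w l) = R v + R w) \<and>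
     (\<forall>a. \<forall>w\<in>fspace N. R (\<lambda>l. a * w l) = smul a (R w))"

definition is_frame ::
  "('k::real_normed_field \<Rightarrow> 'b::real_normed_vector \<Rightarrow> 'b) \<Rightarrow>
   (('l::topological_space \<Rightarrow> 'k) \<Rightarrow> ennreal) \<Rightarrow> ('l \<Rightarrow> ('b \<Rightarrow>\<^sub>L 'k)) \<Rightarrow> bool" where
  "is_frame smul N \<phi> \<longleftrightarrow>
     admissible N \<and>
     range \<phi> \<subseteq> dual smul \<and>
     continuous_on UNIV \<phi> \<and>
     (\<exists>A B :: real. 0 < A \<and> A \<le> B \<and>
        (\<forall>x. ennreal (A * norm x) \<le> N (coeffs \<phi> x) \<and> N (coeffs \<phi> x) \<le> ennreal (B * norm x))) \<and>
     (\<exists>R. linear_on_fspace smul N R \<and>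
        continuous_map (Metric_space.mtopology (fspace N) (fdist N)) euclidean R \<and>
        (\<forall>x. R (coeffs \<phi> x) = x))"

end

theory Submission
  imports Defs
begin

text \<open>
  Suppose that the magnitudes of the coefficients of \<open>x\<^sub>n\<close> converge in the function space to those
  of \<open>z\<close>. The lower frame bound makes \<open>x\<^sub>n\<close> bounded, so reflexivity yields a weak cluster point
  \<open>y\<close>. Norm convergence in a solid space implies pointwise convergence, hence \<open>y\<close> and \<open>z\<close> have the
  same magnitudes, and injectivity gives \<open>z = \<tau> y\<close> with \<open>\<tau>\<close> unimodular. What remains is that the
  weak convergence is in fact strong (\<open>frame_cluster_point\<close>). By the lower frame bound it suffices
  that the coefficients of \<open>x\<^sub>n - y\<close> tend to zero in the function space. On a compact set \<open>K\<close>
  they do so uniformly, because a bounded weakly convergent family converges uniformly on the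
  norm-compact set \<open>\<phi> ` K\<close> of functionals. Off \<open>K\<close> the coefficients of \<open>y\<close> are small, by density of
  the compactly supported elements, and the convergence of the magnitudes forces those of \<open>x\<^sub>n\<close> to
  be small there too.

  Cluster points are handled with filters in place of subsequences. Then weak compactness
  follows from Tychonoff's theorem (\<open>reflexive_weak_cluster_point\<close>): the evaluations
  \<open>\<psi> \<mapsto> \<psi> x\<^sub>n\<close> lie in a product of compact balls, and any of their cluster points is a bounded
  linear functional on the dual, which reflexivity represents by a vector.
\<close>

section \<open>Weak cluster points in reflexive spaces\<close>

text \<open>The closed ball consists of the products of a modulus and a unit scalar.\<close>

lemma compact_cball_scalars: "compact (cball (0 :: 'k::real_or_complex) r)"
proof -
  have "cball 0 r = (\<lambda>(s, t). of_real s * t) ` ({0..r} \<times> {t :: 'k. norm t = 1})" (is "_ = ?R")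
  proof (intro equalityI subsetI)
    fix z :: 'k assume z: "z \<in> cball 0 r"
    show "z \<in> ?R"
    proof (cases "z = 0")
      case True
      then show ?thesis using z by (auto intro!: image_eqI[of _ _ "(0, 1)"])
    next
      case False
      then show ?thesis using z
        by (auto intro!: image_eqI[of _ _ "(norm z, z / of_real (norm z))"] simp: norm_divide)
    qed
  qed (auto simp: norm_mult)
  moreover have "compact ({0..r} \<times> {t :: 'k. norm t = 1})"
    by (intro compact_Times compact_unit_scalars) auto
  moreover have "continuous_on ({0..r} \<times> {t :: 'k. norm t = 1}) (\<lambda>(s, t). of_real s * t)"
    unfolding case_prod_unfold by (intro continuous_intros)
  ultimately show ?thesis by (metis compact_continuous_image)
qed

text \<open>
  The filter counterpart of passing to a convergent subsequence: refine \<open>F\<close> by the neighbourhoods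
  of a cluster point. Every limit along \<open>F\<close> persists along the finer filter.
\<close>

lemma compact_cluster_filter:
  assumes "compact U" "F \<noteq> bot" "eventually (\<lambda>i. f i \<in> U) F"
  shows "\<exists>G u. G \<le> F \<and> G \<noteq> bot \<and> u \<in> U \<and> (f \<longlongrightarrow> u) G"
proof -
  have "filtermap f F \<noteq> bot" "eventually (\<lambda>x. x \<in> U) (filtermap f F)"
    using assms(2,3) by (simp_all add: filtermap_bot_iff eventually_filtermap)
  then obtain u where u: "u \<in> U" "inf (nhds u) (filtermap f F) \<noteq> bot"
    using assms(1) unfolding compact_filter by blast
  define G where "G = inf (filtercomap f (nhds u)) F"
  have "G \<noteq> bot"
  proof
    assume "G = bot"
    then obtain P Q where PQ: "eventually P (filtercomap f (nhds u))" "eventually Q F"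
      "\<And>i. \<not> (P i \<and> Q i)"
      unfolding G_def trivial_limit_def eventually_inf by blast
    from PQ(1) obtain P' where P': "eventually P' (nhds u)" "\<And>i. P' (f i) \<Longrightarrow> P i"
      unfolding eventually_filtercomap by blast
    have "eventually (\<lambda>i. \<not> P' (f i)) F"
      using PQ(2) by (rule eventually_mono) (use PQ(3) P'(2) in blast)
    then have "eventually (\<lambda>x. \<not> P' x) (filtermap f F)"
      by (simp add: eventually_filtermap)
    with P'(1) have "eventually (\<lambda>_. False) (inf (nhds u) (filtermap f F))"
      unfolding eventually_inf by blast
    then show False using u(2) by (simp add: trivial_limit_def)
  qed
  moreover have "(f \<longlongrightarrow> u) G" unfolding G_def
    by (rule filterlim_mono[OF filterlim_filtercomap order_refl]) simp
  moreover have "G \<le> F" by (simp add: G_def)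
  ultimately show ?thesis using u(1) by blast
qed

text \<open>
  The cluster point of the evaluations is taken in the space of all functions on the bounded
  real-linear maps, where boundedness by \<open>M\<close> is a product of compact balls; linearity is inherited
  from the evaluations by uniqueness of limits.
\<close>

lemma reflexive_weak_cluster_point:
  fixes smul :: "'k::real_or_complex \<Rightarrow> 'b::real_normed_vector \<Rightarrow> 'b"
  assumes "reflexive smul" and F: "F \<noteq> bot" and bdd: "eventually (\<lambda>i. norm (x i) \<le> M) F"
  shows "\<exists>G y. G \<le> F \<and> G \<noteq> bot \<and>
    (\<forall>\<psi>\<in>dual smul. ((\<lambda>i. blinfun_apply \<psi> (x i)) \<longlongrightarrow> blinfun_apply \<psi> y) G)"
proof -
  define U where "U = (PiE UNIV (\<lambda>\<psi> :: 'b \<Rightarrow>\<^sub>L 'k. cball (0 :: 'k) (norm \<psi> * M)))"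
  have "compact U"
    using compactin_PiE[of "\<lambda>_. euclidean" UNIV "\<lambda>\<psi> :: 'b \<Rightarrow>\<^sub>L 'k. cball (0 :: 'k) (norm \<psi> * M)"]
    by (simp add: U_def euclidean_product_topology compact_cball_scalars)
  moreover have "eventually (\<lambda>i. (\<lambda>\<psi>. blinfun_apply \<psi> (x i)) \<in> U) F"
    using bdd
  proof eventually_elim
    case (elim i)
    have "norm (blinfun_apply \<psi> (x i)) \<le> norm \<psi> * M" for \<psi> :: "'b \<Rightarrow>\<^sub>L 'k"
      using norm_blinfun[of \<psi> "x i"] mult_left_mono[OF elim, of "norm \<psi>"] by simp
    then show ?case by (auto simp: U_def PiE_iff)
  qed
  ultimately obtain G E where G: "G \<le> F" "G \<noteq> bot" and E: "E \<in> U"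
    and lim: "((\<lambda>i \<psi>. blinfun_apply \<psi> (x i)) \<longlongrightarrow> E) G"
    using compact_cluster_filter[of U F "\<lambda>i \<psi>. blinfun_apply \<psi> (x i)"] F by blast
  have lim: "((\<lambda>i. blinfun_apply \<psi> (x i)) \<longlongrightarrow> E \<psi>) G" for \<psi>
    by (rule continuous_on_tendsto_compose[OF continuous_on_product_coordinates lim]) auto
  have "E (\<psi> + \<theta>) = E \<psi> + E \<theta>" for \<psi> \<theta>
    using tendsto_unique[OF G(2) lim[of "\<psi> + \<theta>"]] tendsto_add[OF lim[of \<psi>] lim[of \<theta>]]
    by (simp add: blinfun.add_left)
  moreover have "E (dual_scale a \<psi>) = a * E \<psi>" for a \<psi>
    using tendsto_unique[OF G(2) lim[of "dual_scale a \<psi>"]] tendsto_mult_left[OF lim[of \<psi>], of a]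
    by (simp add: dual_scale_apply)
  moreover have "norm (E \<psi>) \<le> M * norm \<psi>" for \<psi>
    using E by (auto simp: U_def PiE_iff mult.commute)
  ultimately have "E \<in> bidual smul"
    unfolding bidual_def by blast
  then obtain y where "\<forall>\<psi>\<in>dual smul. E \<psi> = blinfun_apply \<psi> y"
    using assms(1) unfolding reflexive_def by blast
  with lim have "\<forall>\<psi>\<in>dual smul. ((\<lambda>i. blinfun_apply \<psi> (x i)) \<longlongrightarrow> blinfun_apply \<psi> y) G"
    by metis
  with G show ?thesis by blast
qed

text \<open>
  A finite net of the compact set reduces the uniform statement to finitely many pointwise ones,
  boundedness of the vectors controlling the error.
\<close>

lemma pointwise_null_uniform_on_compact:
  fixes C :: "('b::real_normed_vector \<Rightarrow>\<^sub>L 'k::real_normed_vector) set"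
  assumes "compact C" and bdd: "eventually (\<lambda>i. norm (u i) \<le> M) G"
    and lim: "\<And>\<psi>. \<psi> \<in> C \<Longrightarrow> ((\<lambda>i. blinfun_apply \<psi> (u i)) \<longlongrightarrow> 0) G" and "\<epsilon> > 0"
  shows "eventually (\<lambda>i. \<forall>\<psi>\<in>C. norm (blinfun_apply \<psi> (u i)) < \<epsilon>) G"
proof -
  define m where "m = \<bar>M\<bar> + 1"
  define d where "d = \<epsilon> / (2 * m)"
  have m: "m > 0" "M \<le> m" by (auto simp: m_def)
  have d: "d > 0" "d * m = \<epsilon> / 2"
    using \<open>\<epsilon> > 0\<close> m(1) by (simp_all add: d_def)
  obtain D where D: "finite D" "D \<subseteq> C" "C \<subseteq> (\<Union>\<theta>\<in>D. ball \<theta> d)"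
    by (rule compactE_image[OF \<open>compact C\<close>, of C "\<lambda>\<theta>. ball \<theta> d"])
      (use d(1) in \<open>auto intro: centre_in_ball[THEN iffD2]\<close>)
  have "eventually (\<lambda>i. \<forall>\<theta>\<in>D. norm (blinfun_apply \<theta> (u i)) < \<epsilon> / 2) G"
  proof (intro eventually_ball_finite D(1) ballI)
    fix \<theta> assume "\<theta> \<in> D"
    then have "((\<lambda>i. blinfun_apply \<theta> (u i)) \<longlongrightarrow> 0) G" using lim D(2) by blast
    then show "eventually (\<lambda>i. norm (blinfun_apply \<theta> (u i)) < \<epsilon> / 2) G"
      using \<open>\<epsilon> > 0\<close> by (intro order_tendstoD(2)[OF tendsto_norm_zero]) auto
  qed
  with bdd show ?thesis
  proof eventually_elim
    case (elim i)
    show ?case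
    proof
      fix \<psi> assume "\<psi> \<in> C"
      then obtain \<theta> where \<theta>: "\<theta> \<in> D" "dist \<theta> \<psi> < d" using D(3) by auto
      have "norm (blinfun_apply (\<psi> - \<theta>) (u i)) \<le> norm (\<psi> - \<theta>) * norm (u i)"
        by (rule norm_blinfun)
      also have "\<dots> \<le> d * m"
        using \<theta>(2) elim(1) m(2) d(1)
        by (intro mult_mono) (auto simp: dist_norm norm_minus_commute)
      finally have "norm (blinfun_apply (\<psi> - \<theta>) (u i)) \<le> \<epsilon> / 2" using d(2) by simp
      moreover have "norm (blinfun_apply \<theta> (u i)) < \<epsilon> / 2" using elim(2) \<theta>(1) by blast
      moreover have "blinfun_apply \<psi> (u i) = blinfun_apply (\<psi> - \<theta>) (u i) + blinfun_apply \<theta> (u i)"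
        by (simp add: blinfun.diff_left)
      ultimately show "norm (blinfun_apply \<psi> (u i)) < \<epsilon>"
        using norm_triangle_lt[of "blinfun_apply (\<psi> - \<theta>) (u i)" "blinfun_apply \<theta> (u i)" \<epsilon>]
        by simp
    qed
  qed
qed

section \<open>Norm estimates in admissible spaces\<close>

context admissible
begin

text \<open>Real-valued on \<^term>\<open>fspace N\<close>, where all estimates take place; zero elsewhere.\<close>

definition fnorm :: "('l \<Rightarrow> 'k) \<Rightarrow> real" where
  "fnorm w = enn2real (N w)"

lemma fnorm_nonneg: "0 \<le> fnorm w"
  by (simp add: fnorm_def)

lemma fdist_fnorm: "fdist N v w = fnorm (\<lambda>l. v l - w l)"
  by (simp add: fdist_def fnorm_def)

lemma ennreal_fnorm: "w \<in> fspace N \<Longrightarrow> ennreal (fnorm w) = N w"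
  by (simp add: fnorm_def fspace_def)

lemma fnorm_scale: "fnorm (\<lambda>l. a * w l) = norm a * fnorm w"
  by (simp add: fnorm_def N_scale enn2real_mult)

lemma fnorm_triangle:
  assumes "v \<in> fspace N" "w \<in> fspace N"
  shows "fnorm (\<lambda>l. v l + w l) \<le> fnorm v + fnorm w"
proof -
  have "ennreal (fnorm (\<lambda>l. v l + w l)) \<le> ennreal (fnorm v + fnorm w)"
    using N_triangle[of v w] assms
    by (simp add: ennreal_fnorm fspace_add fnorm_nonneg)
  then show ?thesis by (simp add: fnorm_nonneg del: ennreal_plus)
qed

lemma solid_mono:
  assumes "z \<in> fspace N" "\<And>l. norm (w l) \<le> norm (z l)"
  shows "w \<in> fspace N" "fnorm w \<le> fnorm z"
proof -
  have "N w \<le> N z" using solid[OF assms] by simp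
  then show "w \<in> fspace N" "fnorm w \<le> fnorm z"
    using assms(1) by (auto simp: fspace_def fnorm_def intro: le_less_trans enn2real_mono)
qed

lemma absf_fspace:
  assumes "w \<in> fspace N"
  shows "absf w \<in> fspace N" "fnorm (absf w) = fnorm w"
  using solid[OF assms, of w] assms by (auto simp: fspace_def fnorm_def)

text \<open>
  Pointwise domination by a sum of three moduli, the form in which solidity and the triangle
  inequality are combined below.
\<close>

lemma fnorm_dominated:
  assumes "a \<in> fspace N" "b \<in> fspace N" "c \<in> fspace N"
    and dom: "\<And>l. norm (w l) \<le> norm (a l) + norm (b l) + norm (c l)"
  shows "fnorm w \<le> fnorm a + fnorm b + fnorm c"
proof -
  define ab where "ab = (\<lambda>l. absf a l + absf b l)"
  define s where "s = (\<lambda>l. ab l + absf c l)"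
  have ab: "ab \<in> fspace N" unfolding ab_def by (intro fspace_add absf_fspace assms)
  then have s: "s \<in> fspace N" unfolding s_def by (intro fspace_add absf_fspace assms)
  have "s l = of_real (norm (a l) + norm (b l) + norm (c l))" for l
    by (simp add: s_def ab_def absf_def)
  then have ws: "norm (w l) \<le> norm (s l)" for l
    using dom[of l] by (simp only: norm_of_real)
  have "fnorm w \<le> fnorm s" using solid_mono(2)[OF s ws] .
  also have "\<dots> \<le> fnorm ab + fnorm c"
    using fnorm_triangle[OF ab absf_fspace(1)[OF assms(3)]] assms by (simp add: s_def absf_fspace)
  also have "fnorm ab \<le> fnorm a + fnorm b"
    using fnorm_triangle[of "absf a" "absf b"] assms by (simp add: ab_def absf_fspace)
  finally show "fnorm w \<le> fnorm a + fnorm b + fnorm c" by simp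
qed

lemma indicator_fspace: "compact L \<Longrightarrow> indicator L \<in> fspace N"
  using indicator_finite by (simp add: fspace_def)

text \<open>Points are compact, so a multiple of their indicator is dominated by the function.\<close>

lemma point_evaluation_bound:
  assumes "w \<in> fspace N"
  shows "norm (w l) * fnorm (indicator {l}) \<le> fnorm w"
proof -
  have "fnorm (\<lambda>m. w l * indicator {l} m) \<le> fnorm w"
    by (rule solid_mono(2)[OF assms]) (auto simp: indicator_def norm_mult)
  then show ?thesis by (simp add: fnorm_scale)
qed

lemma fnorm_indicator_point_pos: "0 < fnorm (indicator {l})"
proof -
  have "(indicator {l} :: 'l \<Rightarrow> 'k) \<noteq> (\<lambda>l. 0)"
    by (metis indicator_simps(1) insertI1 zero_neq_one)
  then have "N (indicator {l}) \<noteq> 0" using N_eq_0_iff by blast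
  moreover have "N (indicator {l}) < \<infinity>" by (rule indicator_finite) simp
  ultimately show ?thesis by (simp add: fnorm_def enn2real_positive_iff zero_less_iff_neq_zero)
qed

lemma fnorm_tendsto_pointwise:
  assumes "\<And>i. w i \<in> fspace N" "((\<lambda>i. fnorm (w i)) \<longlongrightarrow> 0) F"
  shows "((\<lambda>i. w i l) \<longlongrightarrow> 0) F"
proof (rule tendsto_norm_zero_cancel, rule tendsto_sandwich[where f = "\<lambda>_. 0"])
  show "((\<lambda>i. fnorm (w i) / fnorm (indicator {l})) \<longlongrightarrow> 0) F"
    using tendsto_divide[OF assms(2) tendsto_const, of "fnorm (indicator {l})"]
      fnorm_indicator_point_pos[of l] by simp
  show "\<forall>\<^sub>F i in F. norm (w i l) \<le> fnorm (w i) / fnorm (indicator {l})"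
    using point_evaluation_bound[OF assms(1)] fnorm_indicator_point_pos[of l]
    by (simp add: pos_le_divide_eq)
qed auto

text \<open>
  A compactly supported approximant vanishes off the closure of its support, so the error of
  approximation bounds the tail there.
\<close>

lemma small_tail:
  assumes z: "z \<in> fspace N" and "\<epsilon> > 0"
  shows "\<exists>K. compact K \<and> fnorm (\<lambda>l. indicator (- K) l * z l) < \<epsilon>"
proof -
  interpret M: Metric_space "fspace N" "fdist N" by (rule Metric_space_fspace)
  have "z \<in> M.mtopology closure_of {w \<in> fspace N. compact (closure {l. w l \<noteq> 0})}"
    using z compact_support_dense by blast
  then obtain w where w: "w \<in> fspace N" "compact (closure {l. w l \<noteq> 0})" "fdist N z w < \<epsilon>"
    using \<open>\<epsilon> > 0\<close> unfolding M.metric_closure_of by auto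
  define K where "K = closure {l. w l \<noteq> 0}"
  have "w l = 0" if "l \<notin> K" for l
    using that closure_subset[of "{l. w l \<noteq> 0}"] by (auto simp: K_def)
  then have "fnorm (\<lambda>l. indicator (- K) l * z l) \<le> fnorm (\<lambda>l. z l - w l)"
    by (intro solid_mono(2) fspace_diff z w) (auto simp: indicator_def)
  with w show ?thesis unfolding fdist_fnorm K_def by force
qed

text \<open>
  The splitting behind strong convergence. On \<open>K\<close> the difference \<open>v - w\<close> is bounded by \<open>\<eta>\<close>; off
  \<open>K\<close> it satisfies \<open>\<bar>v - w\<bar> \<le> \<bar>\<bar>v\<bar> - \<bar>w\<bar>\<bar> + 2 \<bar>w\<bar>\<close>, so the magnitudes and the tail of \<open>w\<close>
  control it there.
\<close>

lemma fnorm_diff_split: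
  assumes "compact K" and v: "v \<in> fspace N" and w: "w \<in> fspace N" and "0 \<le> \<eta>"
    and on_K: "\<And>l. l \<in> K \<Longrightarrow> norm (v l - w l) \<le> \<eta>"
  shows "fnorm (\<lambda>l. v l - w l) \<le>
    \<eta> * fnorm (indicator K) + fdist N (absf v) (absf w)
      + 2 * fnorm (\<lambda>l. indicator (- K) l * w l)"
proof -
  define a b c where "a = (\<lambda>l. of_real \<eta> * indicator K l :: 'k)"
    and "b = (\<lambda>l. absf v l - absf w l)"
    and "c = (\<lambda>l. 2 * (indicator (- K) l * w l))"
  have tail: "(\<lambda>l. indicator (- K) l * w l) \<in> fspace N"
    by (rule solid_mono(1)[OF w]) (auto simp: indicator_def)
  have fin: "a \<in> fspace N" "b \<in> fspace N" "c \<in> fspace N"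
    unfolding a_def b_def c_def
    by (intro fspace_scale fspace_diff indicator_fspace absf_fspace v w tail assms)+
  have nb: "norm (b l) = \<bar>norm (v l) - norm (w l)\<bar>" for l
    unfolding b_def absf_def of_real_diff[symmetric] norm_of_real ..
  have "norm (v l - w l) \<le> norm (a l) + norm (b l) + norm (c l)" for l
  proof (cases "l \<in> K")
    case True
    then show ?thesis using on_K[OF True] \<open>0 \<le> \<eta>\<close> by (simp add: a_def add_increasing2)
  next
    case False
    then have "norm (c l) = 2 * norm (w l)" by (simp add: c_def norm_mult)
    then show ?thesis
      using norm_triangle_ineq4[of "v l" "w l"] nb[of l] norm_ge_zero[of "a l"] by linarith
  qed
  from fnorm_dominated[OF fin this] show ?thesis
    using \<open>0 \<le> \<eta>\<close> by (simp add: a_def b_def c_def fnorm_scale fdist_fnorm)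
qed

end

section \<open>Strong cluster points from convergence of magnitudes\<close>

text \<open>
  The compactness behind the theorem: \<open>y\<close> is the weak cluster point supplied by reflexivity, and the
  splitting \<open>fnorm_diff_split\<close> upgrades the convergence to a strong one. The family \<open>x\<close>
  itself need not converge along \<open>F\<close>, since its phase may vary freely with the index.
\<close>

lemma frame_cluster_point:
  fixes smul :: "'k::real_or_complex \<Rightarrow> 'b::real_normed_vector \<Rightarrow> 'b"
    and N :: "('l::topological_space \<Rightarrow> 'k) \<Rightarrow> ennreal"
  assumes refl: "reflexive smul" and frame: "is_frame smul N \<phi>" and F: "F \<noteq> bot"
    and lim: "((\<lambda>i. fdist N (absf (coeffs \<phi> (x i))) (absf (coeffs \<phi> z))) \<longlongrightarrow> 0) F"
  shows "\<exists>G y. G \<le> F \<and> G \<noteq> bot \<and> (x \<longlongrightarrow> y) G \<and> absf (coeffs \<phi> y) = absf (coeffs \<phi> z)"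
proof -
  interpret admissible N using frame by (simp add: is_frame_def)
  have dual: "\<phi> l \<in> dual smul" for l
    using frame by (auto simp: is_frame_def)
  have cont: "continuous_on UNIV \<phi>"
    using frame by (simp add: is_frame_def)
  obtain A B where "0 < A"
    and lower_N: "\<And>x. ennreal (A * norm x) \<le> N (coeffs \<phi> x)"
    and upper_N: "\<And>x. N (coeffs \<phi> x) \<le> ennreal (B * norm x)"
    using frame unfolding is_frame_def by blast
  have fin: "coeffs \<phi> x \<in> fspace N" for x
    using upper_N[of x] by (auto simp: fspace_def intro: le_less_trans)
  note afin = absf_fspace(1)[OF fin]
  have lower: "A * norm x \<le> fnorm (coeffs \<phi> x)" for x
    using lower_N[of x] \<open>0 < A\<close> by (simp add: ennreal_fnorm[OF fin, symmetric] fnorm_nonneg)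
  have coeffs_diff: "coeffs \<phi> (x - y) = (\<lambda>l. coeffs \<phi> x l - coeffs \<phi> y l)" for x y
    by (simp add: coeffs_def blinfun.diff_right)

  define M where "M = (1 + fnorm (coeffs \<phi> z)) / A"
  have "eventually (\<lambda>i. fdist N (absf (coeffs \<phi> (x i))) (absf (coeffs \<phi> z)) < 1) F"
    using order_tendstoD(2)[OF lim] by simp
  then have bdd: "eventually (\<lambda>i. norm (x i) \<le> M) F"
  proof eventually_elim
    case (elim i)
    have "A * norm (x i) \<le> fnorm (absf (coeffs \<phi> (x i)))"
      using lower by (simp add: absf_fspace(2)[OF fin])
    also have "\<dots> \<le> fdist N (absf (coeffs \<phi> (x i))) (absf (coeffs \<phi> z)) + fnorm (absf (coeffs \<phi> z))"
      using fnorm_triangle[OF fspace_diff[OF afin afin] afin, of "x i" z z]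
      by (simp add: fdist_fnorm)
    also have "\<dots> \<le> 1 + fnorm (coeffs \<phi> z)"
      using elim by (simp add: absf_fspace(2)[OF fin])
    finally show ?case using \<open>0 < A\<close> by (simp add: M_def pos_le_divide_eq mult.commute)
  qed
  from reflexive_weak_cluster_point[OF refl F bdd] obtain G y where G: "G \<le> F" "G \<noteq> bot"
    and weak: "\<And>\<psi>. \<psi> \<in> dual smul \<Longrightarrow> ((\<lambda>i. blinfun_apply \<psi> (x i)) \<longlongrightarrow> blinfun_apply \<psi> y) G"
    by blast
  note bdd = filter_leD[OF G(1) bdd]
  note lim = tendsto_mono[OF G(1) lim]

  \<comment> \<open>Along \<open>G\<close> the magnitudes converge pointwise to those of \<open>y\<close> and to those of \<open>z\<close>.\<close>
  have same: "absf (coeffs \<phi> y) = absf (coeffs \<phi> z)"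
  proof
    fix l
    have "((\<lambda>i. absf (coeffs \<phi> (x i)) l - absf (coeffs \<phi> z) l) \<longlongrightarrow> 0) G"
      using lim by (intro fnorm_tendsto_pointwise fspace_diff afin) (simp add: fdist_fnorm)
    moreover have "((\<lambda>i. absf (coeffs \<phi> (x i)) l - absf (coeffs \<phi> z) l) \<longlongrightarrow>
        absf (coeffs \<phi> y) l - absf (coeffs \<phi> z) l) G"
      unfolding absf_def coeffs_def by (intro tendsto_intros weak dual)
    ultimately show "absf (coeffs \<phi> y) l = absf (coeffs \<phi> z) l"
      using tendsto_unique[OF G(2)] by fastforce
  qed

  have "(x \<longlongrightarrow> y) G"
  proof (rule tendstoI)
    fix e :: real assume "0 < e"
    \<comment> \<open>A quarter each for \<open>K\<close> and for the distance of the magnitudes, half for the tail of \<open>y\<close>,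
      which counts twice.\<close>
    define \<epsilon> where "\<epsilon> = A * e / 4"
    have "\<epsilon> > 0" using \<open>0 < e\<close> \<open>0 < A\<close> by (simp add: \<epsilon>_def)
    obtain K where K: "compact K" "fnorm (\<lambda>l. indicator (- K) l * coeffs \<phi> y l) < \<epsilon>"
      using small_tail[OF fin \<open>\<epsilon> > 0\<close>] by blast
    define \<eta> where "\<eta> = \<epsilon> / (fnorm (indicator K) + 1)"
    have \<eta>: "\<eta> > 0" "\<eta> * fnorm (indicator K) \<le> \<epsilon>"
      using \<open>\<epsilon> > 0\<close> fnorm_nonneg[of "indicator K"] by (auto simp: \<eta>_def field_simps)
    have "compact (\<phi> ` K)"
      using K(1) cont by (meson compact_continuous_image continuous_on_subset subset_UNIV)
    moreover have "eventually (\<lambda>i. norm (x i - y) \<le> M + norm y) G"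
      using bdd by eventually_elim (use norm_triangle_ineq4 in \<open>fastforce intro: order_trans\<close>)
    moreover have "((\<lambda>i. blinfun_apply \<psi> (x i - y)) \<longlongrightarrow> 0) G" if "\<psi> \<in> \<phi> ` K" for \<psi>
      using weak[of \<psi>] that dual by (auto simp: blinfun.diff_right LIM_zero_iff)
    ultimately have "eventually (\<lambda>i. \<forall>\<psi>\<in>\<phi> ` K. norm (blinfun_apply \<psi> (x i - y)) < \<eta>) G"
      using \<eta>(1) by (intro pointwise_null_uniform_on_compact)
    moreover have "eventually
        (\<lambda>i. fdist N (absf (coeffs \<phi> (x i))) (absf (coeffs \<phi> y)) < \<epsilon>) G"
      unfolding same using order_tendstoD(2)[OF lim \<open>\<epsilon> > 0\<close>] .
    ultimately show "eventually (\<lambda>i. dist (x i) y < e) G"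
    proof eventually_elim
      case (elim i)
      have "norm (coeffs \<phi> (x i) l - coeffs \<phi> y l) \<le> \<eta>" if "l \<in> K" for l
        using elim(1) that by (auto simp: coeffs_def blinfun.diff_right intro: less_imp_le)
      then have "fnorm (coeffs \<phi> (x i - y)) \<le>
          \<eta> * fnorm (indicator K) + fdist N (absf (coeffs \<phi> (x i))) (absf (coeffs \<phi> y))
            + 2 * fnorm (\<lambda>l. indicator (- K) l * coeffs \<phi> y l)"
        unfolding coeffs_diff using \<eta>(1) by (intro fnorm_diff_split K(1) fin) auto
      then have "A * norm (x i - y) < 4 * \<epsilon>"
        using lower[of "x i - y"] \<eta>(2) elim(2) K(2) by linarith
      then show ?case using \<open>0 < A\<close> by (simp add: \<epsilon>_def dist_norm)
    qed
  qed
  with G same show ?thesis by blast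
qed

section \<open>Continuity of the inverse\<close>

theorem theorem3p3:
  fixes smul :: "'k::real_or_complex \<Rightarrow> 'b::banach \<Rightarrow> 'b"
    and N :: "('l::topological_space \<Rightarrow> 'k) \<Rightarrow> ennreal"
    and \<phi> :: "'l \<Rightarrow> ('b \<Rightarrow>\<^sub>L 'k)"
  assumes "normed_space_over smul"
    and "reflexive smul"
    and "is_frame smul N \<phi>"
    and "inj_on (abs_coeffs \<phi>) (phase_space smul)"
  shows "continuous_map
           (Metric_space.mtopology (abs_coeffs \<phi> ` phase_space smul) (fdist N))
           (Metric_space.mtopology (phase_space smul) (phase_dist smul))
           (inv_into (phase_space smul) (abs_coeffs \<phi>))"
proof -
  interpret normed_space_over smul by fact
  interpret admissible N using assms(3) by (simp add: is_frame_def)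
  have dual: "range \<phi> \<subseteq> dual smul" using assms(3) by (simp add: is_frame_def)
  have "coeffs \<phi> x \<in> fspace N" for x
    using assms(3) by (auto simp: is_frame_def fspace_def intro: le_less_trans)
  then have "abs_coeffs \<phi> ` phase_space smul \<subseteq> fspace N"
    by (auto simp: abs_coeffs_def absf_fspace)
  then interpret D: Metric_space "abs_coeffs \<phi> ` phase_space smul" "fdist N"
    by (rule Metric_space.subspace[OF Metric_space_fspace])

  \<comment> \<open>Convergence along a cluster filter suffices: a violation of continuity yields a sequence all
    of whose members stay away from \<open>P\<close>.\<close>
  have key: "\<exists>\<delta>>0. \<forall>Q\<in>phase_space smul.
      fdist N (abs_coeffs \<phi> P) (abs_coeffs \<phi> Q) < \<delta> \<longrightarrow> phase_dist smul P Q < \<epsilon>"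
    if P: "P \<in> phase_space smul" and "\<epsilon> > 0" for P \<epsilon>
  proof (rule ccontr)
    assume "\<not> ?thesis"
    then have "\<forall>n. \<exists>Q. Q \<in> phase_space smul \<and>
        fdist N (abs_coeffs \<phi> P) (abs_coeffs \<phi> Q) < inverse (real (Suc n)) \<and>
        \<not> phase_dist smul P Q < \<epsilon>"
      by (metis inverse_positive_iff_positive of_nat_0_less_iff zero_less_Suc)
    then obtain Q where Q: "\<And>n. Q n \<in> phase_space smul"
      and near: "\<And>n. fdist N (abs_coeffs \<phi> P) (abs_coeffs \<phi> (Q n)) < inverse (real (Suc n))"
      and far: "\<And>n. \<not> phase_dist smul P (Q n) < \<epsilon>"
      by metis
    define x where "x n = rep (Q n)" for n
    have "(\<lambda>n. fdist N (abs_coeffs \<phi> P) (abs_coeffs \<phi> (Q n))) \<longlonglongrightarrow> 0"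
      by (rule tendsto_sandwich[OF _ _ tendsto_const LIMSEQ_inverse_real_of_nat])
        (auto intro!: always_eventually less_imp_le near simp del: of_nat_Suc)
    then have "(\<lambda>n. fdist N (absf (coeffs \<phi> (x n))) (absf (coeffs \<phi> (rep P)))) \<longlonglongrightarrow> 0"
      by (simp add: x_def abs_coeffs_def[symmetric] D.commute)
    then obtain G y where G: "G \<le> sequentially" "G \<noteq> bot" and lim: "(x \<longlongrightarrow> y) G"
      and same: "absf (coeffs \<phi> y) = absf (coeffs \<phi> (rep P))"
      using frame_cluster_point[OF assms(2,3) sequentially_bot] by blast
    have "phase_rel smul `` {y} \<in> phase_space smul"
      by (simp add: phase_space_def quotientI)
    moreover have "abs_coeffs \<phi> (phase_rel smul `` {y}) = abs_coeffs \<phi> P"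
      using same by (simp add: abs_coeffs_class[OF dual] abs_coeffs_def[of \<phi> P])
    ultimately have "phase_rel smul `` {y} = P"
      using inj_onD[OF assms(4)] P by blast
    then obtain \<tau> where \<tau>: "norm \<tau> = 1" "rep P = smul \<tau> y"
      using rep_class by blast
    have "eventually (\<lambda>n. dist (x n) y < \<epsilon>) G"
      using lim \<open>\<epsilon> > 0\<close> by (rule tendstoD)
    then obtain n where n: "dist (x n) y < \<epsilon>"
      using G(2) eventually_happens by blast
    have "phase_dist smul P (Q n) = vec_phase_dist smul y (x n)"
      by (simp add: phase_dist_def \<tau> x_def vec_phase_dist_scale_left)
    also have "\<dots> \<le> norm (y - smul 1 (x n))"
      by (rule vec_phase_dist_le) simp
    also have "\<dots> < \<epsilon>"
      using n by (simp add: dist_norm norm_minus_commute)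
    finally show False using far by blast
  qed

  show ?thesis
    unfolding D.metric_continuous_map[OF Metric_space_phase_space[OF assms(1)]]
  proof (intro conjI ballI allI impI)
    show "inv_into (phase_space smul) (abs_coeffs \<phi>) ` abs_coeffs \<phi> ` phase_space smul
        \<subseteq> phase_space smul"
      by (auto intro: inv_into_into)
    fix a \<epsilon> assume "a \<in> abs_coeffs \<phi> ` phase_space smul" and "0 < (\<epsilon> :: real)"
    then show "\<exists>\<delta>>0. \<forall>b. b \<in> abs_coeffs \<phi> ` phase_space smul \<and> fdist N a b < \<delta> \<longrightarrow>
        phase_dist smul (inv_into (phase_space smul) (abs_coeffs \<phi>) a)
          (inv_into (phase_space smul) (abs_coeffs \<phi>) b) < \<epsilon>"
      using key by (force simp: inv_into_f_f[OF assms(4)])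
  qed
qed

end
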